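(* Let $c$ be a medium with a bounded defect in $(x_0,x_1)$, with $x_0<x_1$, and let $T(\omega)$ be the transfer matrix of its periodic part. Let $u$ be a localised eigenmode of $u''+\frac{\omega^2}{c^2(x)}u=0$ with eigenfrequency $\omega\in\mathbb{R}\setminus\sigma(c_0)$. Then $$u(x_n)=O\big(|\lambda_1(\omega)|^{|n|}\big)\quad\text{and}\quad u'(x_n)=O\big(|\lambda_1(\omega)|^{|n|}\big)\quad\text{as } n\to\pm\infty,$$ where $\lambda_1(\omega)$ is the eigenvalue of $T(\omega)$ satisfying $|\lambda_1(\omega)|<1$.
   Context: Medium with a bounded defect: let $h>0$ and let $\{x_n:n\in\mathbb{Z}\}\subset\mathbb{R}$ satisfy $x_{n+1}-x_n=h$ for all $n\in\mathbb{Z}\setminus\{0\}$, with $x_1-x_0>0$ not necessarily equal to $h$. The function $c:\mathbb{R}\to\mathbb{R}$ is strictly positive and piecewise smooth (finitely many smooth pieces on bounded intervals, with positive one-sided limits), and outside the defect region $(x_0,x_1)$ it is periodic, $c(x_n+t)=c(x_m+t)$ for all $t\in[0,h)$ and $n,m\in\mathbb{Z}\setminus\{0\}$, and symmetric, $c(x_n+t)=c(x_{n+1}-t)$ for all $t\in[0,h)$ and $n\in\mathbb{Z}\setminus\{0\}$. Inside $(x_0,x_1)$ it is otherwise arbitrary. Solutions: a solution of $u''+\frac{\omega^2}{c^2(x)}u=0$ is a $C^1$ function $u\not\equiv 0$ whose derivative is locally absolutely continuous and which satisfies the equation away from the discontinuities of $c$. A localised eigenmode with eigenfrequency $\omega$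 is a solution $u\in L^2(\mathbb{R})$ that decays at $\pm\infty$; in particular $u(x_n)\to0$ and $u'(x_n)\to 0$ as $n\to\pm\infty$. Spectrum of the unperturbed medium: $c_0$ denotes the $h$-periodic medium without defect (i.e. with $x_0=x_1$), obtained by repeating the unit cell. $\sigma(c_0)$ is the set of $\omega$ for which the equation with $c=c_0$ has a nonzero solution that is either in $L^2(\mathbb{R})$ or, for some $\alpha\in\mathbb{R}$, satisfies $u(x+h)=e^{\mathrm{i}\alpha h}u(x)$. Transfer matrix: $T(\omega)\in\mathbb{R}^{2\times2}$ is the matrix such that any solution of the equation satisfies $(u(x_{n+1}),u'(x_{n+1}))^\top=T(\omega)(u(x_n),u'(x_n))^\top$ for $n\in\mathbb{Z}\setminus\{0\}$. For $\omega\in\mathbb{R}\setminus\sigma(c_0)$ the eigenvalues of $T(\omega)$ are real with $|\lambda_1|<1<|\lambda_2|$. *)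

theory Defs
  imports "HOL-Analysis.Analysis" "HOL-Library.Landau_Symbols" "HOL-Library.Real_Mod"
begin

subsection \<open>Media\<close>

text \<open>
  A smooth (\<open>C\<^sup>\<infinity>\<close>) function off a locally finite set, with positive one-sided limits.  The set
  \<open>{a<..<b} - S\<close> is open, so having all iterated derivatives at each of its points is smoothness
  there.  Nothing is required of the derivatives at the ends of the smooth pieces.
\<close>

definition piecewise_smooth :: "(real \<Rightarrow> real) \<Rightarrow> bool" where
  "piecewise_smooth c \<longleftrightarrow>
     (\<forall>a b. \<exists>S. finite S \<and>
        (\<forall>y \<in> {a<..<b} - S. \<forall>k::nat. ((deriv ^^ k) c) differentiable (at y))) \<and>
     (\<forall>y. (\<exists>l>0. (c \<longlongrightarrow> l) (at_left y)) \<and> (\<exists>r>0. (c \<longlongrightarrow> r) (at_right y)))"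

definition defect_medium :: "real \<Rightarrow> (int \<Rightarrow> real) \<Rightarrow> (real \<Rightarrow> real) \<Rightarrow> bool" where
  "defect_medium h x c \<longleftrightarrow>
     h > 0 \<and>
     (\<forall>n. n \<noteq> 0 \<longrightarrow> x (n + 1) - x n = h) \<and>
     x 0 < x 1 \<and>
     (\<forall>y. c y > 0) \<and>
     piecewise_smooth c \<and>
     (\<forall>n m. \<forall>t \<in> {0..<h}. n \<noteq> 0 \<longrightarrow> m \<noteq> 0 \<longrightarrow> c (x n + t) = c (x m + t)) \<and>
     (\<forall>n. \<forall>t \<in> {0..<h}. n \<noteq> 0 \<longrightarrow> c (x n + t) = c (x (n + 1) - t))"

text \<open>
  The unperturbed medium: the \<open>h\<close>-periodic repetition of the unit cell \<open>[x\<^sub>1, x\<^sub>1 + h)\<close>.  (Which cell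
  outside the defect is repeated, and where it is placed, does not affect the spectrum.)
\<close>

definition unperturbed :: "real \<Rightarrow> (int \<Rightarrow> real) \<Rightarrow> (real \<Rightarrow> real) \<Rightarrow> real \<Rightarrow> real" where
  "unperturbed h x c y = c (x 1 + (y - x 1) rmod h)"


subsection \<open>Solutions and localised eigenmodes\<close>

abbreviation D\<^sub>x :: "(real \<Rightarrow> complex) \<Rightarrow> real \<Rightarrow> complex" where
  "D\<^sub>x u \<equiv> (\<lambda>y. vector_derivative u (at y))"

text \<open>
  Absolute continuity of functions of a real variable; the constant
  \<^const>\<open>absolutely_continuous\<close> is the unrelated notion for measures.
  The pairs \<open>(s, t)\<close> in \<open>P\<close> are the end points of non-overlapping subintervals.
\<close>

definition abs_continuous_on :: "real set \<Rightarrow> (real \<Rightarrow> 'a::real_normed_vector) \<Rightarrow> bool" where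
  "abs_continuous_on I f \<longleftrightarrow>
     (\<forall>\<epsilon>>0. \<exists>\<delta>>0. \<forall>P. finite P \<longrightarrow>
        (\<forall>(s, t) \<in> P. s \<le> t \<and> {s..t} \<subseteq> I) \<longrightarrow>
        pairwise (\<lambda>(s, t) (s', t'). {s<..<t} \<inter> {s'<..<t'} = {}) P \<longrightarrow>
        (\<Sum>(s, t)\<in>P. t - s) < \<delta> \<longrightarrow>
        (\<Sum>(s, t)\<in>P. norm (f t - f s)) < \<epsilon>)"

definition locally_abs_continuous :: "(real \<Rightarrow> 'a::real_normed_vector) \<Rightarrow> bool" where
  "locally_abs_continuous f \<longleftrightarrow> (\<forall>a b. abs_continuous_on {a..b} f)"

text \<open>
  Solutions of \<open>u'' + (\<omega>\<^sup>2 / c\<^sup>2) u = 0\<close> are complex-valued (as the quasi-periodic ones in the spectrum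
  have to be); real solutions are a special case.
\<close>

definition is_solution :: "(real \<Rightarrow> real) \<Rightarrow> real \<Rightarrow> (real \<Rightarrow> complex) \<Rightarrow> bool" where
  "is_solution c \<omega> u \<longleftrightarrow>
     (\<exists>y. u y \<noteq> 0) \<and>
     u C1_differentiable_on UNIV \<and>
     locally_abs_continuous (D\<^sub>x u) \<and>
     (\<forall>y. isCont c y \<longrightarrow>
        (D\<^sub>x u) differentiable (at y) \<and>
        vector_derivative (D\<^sub>x u) (at y) + of_real (\<omega>\<^sup>2 / (c y)\<^sup>2) * u y = 0)"

definition square_integrable :: "(real \<Rightarrow> complex) \<Rightarrow> bool" where
  "square_integrable u \<longleftrightarrow>
     u \<in> borel_measurable lborel \<and> integrable lborel (\<lambda>y. (norm (u y))\<^sup>2)"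

definition localised_eigenmode :: "(real \<Rightarrow> real) \<Rightarrow> real \<Rightarrow> (real \<Rightarrow> complex) \<Rightarrow> bool" where
  "localised_eigenmode c \<omega> u \<longleftrightarrow>
     is_solution c \<omega> u \<and> square_integrable u \<and> (u \<longlongrightarrow> 0) at_top \<and> (u \<longlongrightarrow> 0) at_bot"

text \<open>The real frequencies \<open>\<omega>\<close> in the spectrum \<open>\<sigma>(c\<^sub>0)\<close> of an \<open>h\<close>-periodic medium \<open>c\<^sub>0\<close>.\<close>

definition medium_spectrum :: "real \<Rightarrow> (real \<Rightarrow> real) \<Rightarrow> real set" where
  "medium_spectrum h c\<^sub>0 =
     {\<omega>. \<exists>u. is_solution c\<^sub>0 \<omega> u \<and>
        (square_integrable u \<or> (\<exists>\<alpha>::real. \<forall>y. u (y + h) = exp (\<i> * of_real (\<alpha> * h)) * u y))}"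


subsection \<open>The transfer matrix\<close>

definition is_transfer_matrix ::
  "(int \<Rightarrow> real) \<Rightarrow> (real \<Rightarrow> real) \<Rightarrow> real \<Rightarrow> real^2^2 \<Rightarrow> bool" where
  "is_transfer_matrix x c \<omega> T \<longleftrightarrow>
     (\<forall>u n. is_solution c \<omega> u \<longrightarrow> n \<noteq> 0 \<longrightarrow>
        (vector [u (x (n + 1)), D\<^sub>x u (x (n + 1))] :: complex^2) =
        map_matrix of_real T *v vector [u (x n), D\<^sub>x u (x n)])"

definition is_eigenvalue :: "real^2^2 \<Rightarrow> real \<Rightarrow> bool" where
  "is_eigenvalue T l \<longleftrightarrow> (\<exists>v. v \<noteq> 0 \<and> T *v v = l *s v)"

end

theory Submission
  imports Defs
begin

text \<open>
  Everything follows from \<open>det T = 1\<close>.  Then the eigenvalues of \<open>T\<close> are \<open>\<lambda>\<close> and \<open>1 / \<lambda>\<close> with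
  \<open>\<lambda> = \<lambda>\<^sub>1\<close>, and by the Cayley-Hamilton theorem each of the two sequences \<open>z\<^sub>n = u(x\<^sub>n)\<close> and
  \<open>z\<^sub>n = u'(x\<^sub>n)\<close> satisfies
  \<open>z\<^bsub>n+2\<^esub> = (\<lambda> + 1 / \<lambda>) z\<^bsub>n+1\<^esub> - z\<^sub>n\<close>
  on either side of the defect.  This recurrence is invariant under \<open>n \<mapsto> - n\<close>, so one argument
  serves both ends: the general solution is a combination of \<open>\<lambda>\<^sup>k\<close> and \<open>\<lambda>\<^bsup>-k\<^esup>\<close>, where \<open>k\<close> is the
  distance from the defect, and a solution that tends to \<open>0\<close> has no growing part.  Hence \<open>z\<close> is exactly
  geometric, with ratio \<open>\<lambda>\<close>, on each side (\<open>decaying_recurrence_geometric\<close>).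

  Two points need analysis.  Firstly, \<open>T\<close> is only known through its action on solutions, so
  \<open>det T = 1\<close> can be derived only if there are enough of them.  Two solutions whose Cauchy
  data at \<open>x\<^sub>1\<close> form the identity matrix are constructed (\<open>solution_exists\<close>); their Cauchy data at
  \<open>x\<^sub>2\<close> form \<open>T\<close>, and their Wronskian is constant (\<open>wronskian_constant\<close>).  The construction writes the
  equation with \<open>q = \<omega>\<^sup>2 / c\<^sup>2\<close> as a Volterra equation and applies the Banach fixed point theorem on the
  whole line in an exponentially weighted supremum norm, which is possible because \<open>c\<close> is bounded
  away from \<open>0\<close> (\<open>defect_medium_bounded_below\<close>) and so \<open>q\<close> is bounded.

  Secondly, \<open>u'(x\<^sub>n) \<rightarrow> 0\<close> has to be deduced from \<open>u \<rightarrow> 0\<close>.  The values \<open>u(x\<^sub>n)\<close> alone do not suffice: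
  if the upper right entry of \<open>T\<close> is \<open>0\<close>, a solution can vanish at all nodes on one side of the defect
  while its derivative grows there.  But
  \<open>u'' = - q u\<close> is as small as \<open>u\<close>, and \<open>u'\<close> is controlled by \<open>u\<close> and \<open>u''\<close> on a unit interval
  (\<open>derivative_norm_le_of_solution_norm_le\<close>).
\<close>

section \<open>Existence for linear equations with a bounded measurable coefficient\<close>

definition locally_integrable :: "(real \<Rightarrow> real) \<Rightarrow> bool" where
  "locally_integrable g \<longleftrightarrow> (\<forall>s t. g integrable_on {s..t})"

text \<open>
  The oriented integral of \<open>g\<close> from \<open>p\<close> to \<open>y\<close>: one of the two intervals is always empty or a point,
  so both signs of \<open>y - p\<close> are covered without a case distinction.
\<close>

definition primitive_from :: "real \<Rightarrow> (real \<Rightarrow> real) \<Rightarrow> real \<Rightarrow> real" where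
  "primitive_from p g y = integral {p..y} g - integral {y..p} g"

lemma primitive_from_base [simp]: "primitive_from p g p = 0"
  by (simp add: primitive_from_def)

lemma primitive_from_diff:
  assumes g: "locally_integrable g" and st: "s \<le> t"
  shows "primitive_from p g t - primitive_from p g s = integral {s..t} g"
proof -
  have I: "integral {a..b} g + integral {b..d} g = integral {a..d} g" if "a \<le> b" "b \<le> d" for a b d
    using g that by (intro Henstock_Kurzweil_Integration.integral_combine) (auto simp: locally_integrable_def)
  have Z: "integral {b..a} g = 0" if "a \<le> b" for a b
    using that by (cases "a = b") auto
  consider "p \<le> s" | "s \<le> p" "p \<le> t" | "t \<le> p" by linarith
  then show ?thesis
  proof cases
    case 1
    then show ?thesis using I[of p s t] Z[of p s] Z[of p t] st by (simp add: primitive_from_def)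
  next
    case 2
    then show ?thesis using I[of s p t] Z[of s p] Z[of p t] by (simp add: primitive_from_def)
  next
    case 3
    then show ?thesis using I[of s t p] Z[of s p] Z[of t p] st by (simp add: primitive_from_def)
  qed
qed

lemma locally_integrable_bounded:
  fixes g :: "real \<Rightarrow> real"
  assumes m: "g \<in> borel_measurable borel" and F: "continuous_on UNIV F" and b: "\<And>s. \<bar>g s\<bar> \<le> F s"
  shows "locally_integrable g"
  unfolding locally_integrable_def
proof (intro allI)
  fix s t
  show "g integrable_on {s..t}"
  proof (rule measurable_bounded_by_integrable_imp_integrable[where g = F])
    have "g \<in> borel_measurable lebesgue" using m by (simp add: borel_measurable_if_D measurable_completion)
    then show "g \<in> borel_measurable (lebesgue_on {s..t})" by (simp add: measurable_restrict_space1)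
    show "F integrable_on {s..t}"
      by (intro integrable_continuous_interval continuous_on_subset[OF F]) auto
  qed (use b in auto)
qed

lemma primitive_from_has_derivative:
  assumes g: "locally_integrable g" and y: "isCont g y"
  shows "(primitive_from p g has_real_derivative g y) (at y)"
proof -
  have "((\<lambda>u. integral {y-1..u} g) has_vector_derivative g y) (at y within ({y-1..y+1} - {}))"
    by (rule integral_has_vector_derivative_continuous_at)
       (use g y in \<open>auto simp: locally_integrable_def intro: continuous_at_imp_continuous_at_within\<close>)
  then have "((\<lambda>u. integral {y-1..u} g) has_vector_derivative g y) (at y)"
    using at_within_Icc_at[of "y-1" y "y+1"] by simp
  then have d: "((\<lambda>u. primitive_from p g (y-1) + integral {y-1..u} g) has_real_derivative g y) (at y)"
    by (auto simp: has_real_derivative_iff_has_vector_derivative intro!: derivative_eq_intros)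
  show ?thesis
  proof (rule DERIV_cong_ev[THEN iffD1, OF refl _ refl d])
    have "eventually (\<lambda>u. y - 1 < u) (nhds y)"
      by (intro order_tendstoD(1)[of "\<lambda>u. u" y]) (auto simp: filterlim_ident)
    then show "eventually (\<lambda>u. primitive_from p g (y-1) + integral {y-1..u} g = primitive_from p g u) (nhds y)"
    proof (rule eventually_mono)
      fix u assume "y - 1 < u"
      then show "primitive_from p g (y-1) + integral {y-1..u} g = primitive_from p g u"
        using primitive_from_diff[OF g, of "y-1" u p] by simp
    qed
  qed
qed

lemma primitive_from_lipschitz:
  assumes g: "locally_integrable g" and B: "\<And>z. z \<in> {s..t} \<Longrightarrow> \<bar>g z\<bar> \<le> B" and st: "s \<le> t"
  shows "\<bar>primitive_from p g t - primitive_from p g s\<bar> \<le> B * (t - s)"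
proof -
  have "norm (integral {s..t} g) \<le> integral {s..t} (\<lambda>_. B)"
    by (rule Henstock_Kurzweil_Integration.integral_norm_bound_integral) (use g B in \<open>auto simp: locally_integrable_def\<close>)
  then show ?thesis using st by (simp add: primitive_from_diff[OF g st] mult.commute)
qed

lemma primitive_from_continuous:
  assumes g: "locally_integrable g"
  shows "continuous_on UNIV (primitive_from p g)"
proof -
  have "isCont (primitive_from p g) y" for y
  proof -
    have "continuous_on {y-1..y+1} (\<lambda>u. integral {y-1..u} g)"
      using g by (intro indefinite_integral_continuous_1) (auto simp: locally_integrable_def)
    then have "continuous_on {y-1..y+1} (\<lambda>u. primitive_from p g (y-1) + integral {y-1..u} g)"
      by (intro continuous_intros)
    also have "?this \<longleftrightarrow> continuous_on {y-1..y+1} (primitive_from p g)"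
    proof (intro continuous_on_cong refl)
      fix u assume "u \<in> {y-1..y+1}"
      then show "primitive_from p g (y-1) + integral {y-1..u} g = primitive_from p g u"
        using primitive_from_diff[OF g, of "y-1" u p] by simp
    qed
    finally show ?thesis by (rule continuous_on_interior) (auto simp: interior_atLeastAtMost_real)
  qed
  then show ?thesis by (simp add: continuous_at_imp_continuous_on)
qed

lemma primitive_from_minus:
  assumes "locally_integrable f" "locally_integrable g"
  shows "primitive_from p (\<lambda>s. f s - g s) y = primitive_from p f y - primitive_from p g y"
  using assms by (simp add: primitive_from_def locally_integrable_def Henstock_Kurzweil_Integration.integral_diff)

text \<open>
  Integration from \<open>p\<close> gains a factor \<open>1 / K\<close> in the supremum norm with weight \<open>exp (K * \<bar>y - p\<bar>)\<close>.
  For large \<open>K\<close> this makes the Volterra operator a contraction on the whole line.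
\<close>

lemma primitive_from_exp_bound:
  assumes g: "locally_integrable g" and K: "0 < K"
    and b: "\<And>s. \<bar>g s\<bar> \<le> C * exp (K * \<bar>s - p\<bar>)"
  shows "\<bar>primitive_from p g y\<bar> \<le> C / K * exp (K * \<bar>y - p\<bar>)"
proof -
  have C: "0 \<le> C" using b[of p] by simp
  have main: "norm (integral {s..t} g) \<le> C / K * exp (K * (t - s))"
    if st: "s \<le> t" and e: "s = p \<or> t = p" for s t
  proof -
    \<comment> \<open>a primitive of the majorant on the side of \<open>p\<close> where \<open>{s..t}\<close> lies\<close>
    let ?F = "if s = p then (\<lambda>z. C / K * exp (K * (z - p))) else (\<lambda>z. - (C / K * exp (K * (p - z))))"
    have "((\<lambda>z. C * exp (K * \<bar>z - p\<bar>)) has_integral ?F t - ?F s) {s..t}"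
    proof (cases "s = p")
      case True
      have "((\<lambda>z. C * exp (K * (z - p))) has_integral C / K * exp (K * (t - p)) - C / K * exp (K * (s - p))) {s..t}"
        using K st by (intro fundamental_theorem_of_calculus)
          (auto simp: has_real_derivative_iff_has_vector_derivative[symmetric] intro!: derivative_eq_intros)
      then have "((\<lambda>z. C * exp (K * \<bar>z - p\<bar>)) has_integral C / K * exp (K * (t - p)) - C / K * exp (K * (s - p))) {s..t}"
        using True by (elim has_integral_eq[rotated]) auto
      then show ?thesis using True by simp
    next
      case False
      then have p: "t = p" using e by simp
      have "((\<lambda>z. C * exp (K * (p - z))) has_integral (- (C / K * exp (K * (p - t)))) - (- (C / K * exp (K * (p - s))))) {s..t}"
        using K st by (intro fundamental_theorem_of_calculus)
          (auto simp: has_real_derivative_iff_has_vector_derivative[symmetric] intro!: derivative_eq_intros)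
      then have "((\<lambda>z. C * exp (K * \<bar>z - p\<bar>)) has_integral (- (C / K * exp (K * (p - t)))) - (- (C / K * exp (K * (p - s))))) {s..t}"
        using p by (elim has_integral_eq[rotated]) auto
      then show ?thesis using False by simp
    qed
    then have i: "(\<lambda>z. C * exp (K * \<bar>z - p\<bar>)) integrable_on {s..t}"
        "integral {s..t} (\<lambda>z. C * exp (K * \<bar>z - p\<bar>)) = ?F t - ?F s"
      by (auto simp: has_integral_iff)
    have "norm (integral {s..t} g) \<le> ?F t - ?F s"
      unfolding i(2)[symmetric]
      by (rule Henstock_Kurzweil_Integration.integral_norm_bound_integral) (use g b i(1) in \<open>auto simp: locally_integrable_def\<close>)
    also have "\<dots> \<le> C / K * exp (K * (t - s))"
      using e C K by auto
    finally show ?thesis .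
  qed
  show ?thesis
  proof (cases "p \<le> y")
    case True
    then show ?thesis using main[of p y] by (cases "p = y") (auto simp: primitive_from_def C K less_imp_le)
  next
    case False
    then show ?thesis using main[of y p] by (auto simp: primitive_from_def)
  qed
qed

text \<open>
  Integrating \<open>f'' = - q f\<close> twice from \<open>p\<close> gives this fixed point equation for \<open>f\<close>.  The substitution
  \<open>f = W w\<close> with the weight \<open>W y = exp (K * \<bar>y - p\<bar>)\<close> turns it into a fixed point equation for a
  bounded continuous function \<open>w\<close>.  The two integrations contribute \<open>1 / K\<^sup>2\<close> and \<open>q\<close> at most \<open>M\<close>,
  so the Lipschitz constant is at most \<open>M / K\<^sup>2\<close>.
\<close>

lemma volterra_fixed_point:
  fixes q :: "real \<Rightarrow> real"
  assumes q: "q \<in> borel_measurable borel" and qM: "\<And>y. \<bar>q y\<bar> \<le> M"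
  obtains f where "continuous_on UNIV f"
    "\<And>y. f y = a + b * (y - p) - primitive_from p (primitive_from p (\<lambda>s. q s * f s)) y"
proof -
  have M: "0 \<le> M" using qM[of 0] by linarith
  \<comment> \<open>\<open>2 * M \<le> K\<^sup>2\<close> gives the contraction constant \<open>1 / 2\<close>, and \<open>1 \<le> K\<close> lets \<open>W\<close> dominate \<open>\<bar>y - p\<bar>\<close>\<close>
  define K where "K = 1 + 2 * M"
  have K: "1 \<le> K" "0 < K" using M by (auto simp: K_def)
  define W where "W y = exp (K * \<bar>y - p\<bar>)" for y
  have W: "continuous_on UNIV W" "W y > 0" "W y \<ge> 1" for y
    unfolding W_def using K by (auto intro!: continuous_intros)
  define g where "g w s = q s * (W s * apply_bcontfun w s)" for w s
  have gb: "\<bar>g w s - g v s\<bar> \<le> (M * dist w v) * W s" for v w s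
  proof -
    have "\<bar>g w s - g v s\<bar> = \<bar>q s\<bar> * (\<bar>apply_bcontfun w s - apply_bcontfun v s\<bar> * W s)"
      using W(2)[of s] by (simp add: g_def right_diff_distrib[symmetric] abs_mult)
    also have "\<dots> \<le> M * (dist w v * W s)"
    proof (rule mult_mono[OF qM _ M])
      show "\<bar>apply_bcontfun w s - apply_bcontfun v s\<bar> * W s \<le> dist w v * W s"
        using dist_bounded[of w s v] W(2)[of s] by (intro mult_right_mono) (simp_all add: dist_real_def)
      show "0 \<le> \<bar>apply_bcontfun w s - apply_bcontfun v s\<bar> * W s"
        using W(2)[of s] by (intro mult_nonneg_nonneg) simp_all
    qed
    finally show ?thesis by (simp add: mult_ac)
  qed
  have g0: "\<bar>g w s\<bar> \<le> (M * dist w 0) * W s" for w s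
    using gb[of w s 0] by (simp add: g_def)
  have contC: "continuous_on UNIV (\<lambda>s. C * W s)" for C
    by (intro continuous_intros W)
  have gm: "g w \<in> borel_measurable borel" for w
    unfolding g_def by (intro borel_measurable_times q borel_measurable_continuous_onI W) auto
  have gi: "locally_integrable (g w)" for w
    by (rule locally_integrable_bounded[OF gm contC g0])
  have bound1: "\<bar>primitive_from p (g w) s\<bar> \<le> M * dist w 0 / K * W s" for w s
    using primitive_from_exp_bound[OF gi K(2) g0[unfolded W_def]] by (simp add: W_def)
  have Jc: "continuous_on UNIV (primitive_from p (g w))" for w
    by (rule primitive_from_continuous[OF gi])
  have Ji: "locally_integrable (primitive_from p (g w))" for w
    using Jc by (auto simp: locally_integrable_def intro!: integrable_continuous_interval intro: continuous_on_subset)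
  have bound2: "\<bar>primitive_from p (primitive_from p (g w)) s\<bar> \<le> M * dist w 0 / K / K * W s" for w s
    using primitive_from_exp_bound[OF Ji K(2) bound1[unfolded W_def]] by (simp add: W_def)
  define P where "P w y = (a + b * (y - p) - primitive_from p (primitive_from p (g w)) y) / W y" for w y
  have Pc: "continuous_on UNIV (P w)" for w
    unfolding P_def using W(2)
    by (intro continuous_intros W primitive_from_continuous[OF Ji]) (auto simp: less_imp_neq[symmetric])
  have Pb: "norm (P w y) \<le> \<bar>a\<bar> + \<bar>b\<bar> + M * dist w 0 / K / K" for w y
  proof -
    have "\<bar>y - p\<bar> \<le> K * \<bar>y - p\<bar>" using K by (simp add: mult_le_cancel_right1)
    also have "\<dots> \<le> W y" unfolding W_def using exp_ge_add_one_self[of "K * \<bar>y - p\<bar>"] by linarith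
    finally have bW: "\<bar>b * (y - p)\<bar> \<le> \<bar>b\<bar> * W y" by (simp add: abs_mult mult_left_mono)
    have aW: "\<bar>a\<bar> \<le> \<bar>a\<bar> * W y" using W(3)[of y] by (simp add: mult_le_cancel_left1)
    have "\<bar>a + b * (y - p) - primitive_from p (primitive_from p (g w)) y\<bar>
        \<le> \<bar>a\<bar> * W y + \<bar>b\<bar> * W y + M * dist w 0 / K / K * W y"
      by (rule order_trans[OF abs_triangle_ineq4 add_mono
            [OF order_trans[OF abs_triangle_ineq add_mono[OF aW bW]] bound2]])
    then have "\<bar>a + b * (y - p) - primitive_from p (primitive_from p (g w)) y\<bar>
        \<le> (\<bar>a\<bar> + \<bar>b\<bar> + M * dist w 0 / K / K) * W y"
      by (simp only: distrib_right)
    then show ?thesis using W(2)[of y] by (simp add: P_def pos_divide_le_eq)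
  qed
  have Pbc: "P w \<in> bcontfun" for w by (rule bcontfun_normI[OF Pc Pb])
  define \<Phi> where "\<Phi> w = Bcontfun (P w)" for w
  have \<Phi>: "apply_bcontfun (\<Phi> w) = P w" for w
    unfolding \<Phi>_def by (rule Bcontfun_inverse[OF Pbc])
  have contr: "dist (\<Phi> w) (\<Phi> v) \<le> 1/2 * dist w v" for w v
  proof (rule dist_bound)
    fix y
    have d1: "\<bar>primitive_from p (g w) s - primitive_from p (g v) s\<bar> \<le> M * dist w v / K * exp (K * \<bar>s - p\<bar>)" for s
    proof -
      have "locally_integrable (\<lambda>s. g w s - g v s)"
        using gi[of w] gi[of v] unfolding locally_integrable_def by (auto intro: Henstock_Kurzweil_Integration.integrable_diff)
      from primitive_from_exp_bound[OF this K(2) gb[of w _ v, unfolded W_def], of s] show ?thesis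
        by (simp add: primitive_from_minus[OF gi gi])
    qed
    have "locally_integrable (\<lambda>s. primitive_from p (g w) s - primitive_from p (g v) s)"
      using Ji[of w] Ji[of v] unfolding locally_integrable_def by (auto intro: Henstock_Kurzweil_Integration.integrable_diff)
    from primitive_from_exp_bound[OF this K(2) d1, of y]
    have d2: "\<bar>primitive_from p (primitive_from p (g w)) y - primitive_from p (primitive_from p (g v)) y\<bar>
        \<le> M * dist w v / K / K * W y"
      by (simp add: primitive_from_minus[OF Ji Ji] W_def)
    have "dist (P w y) (P v y)
        = \<bar>primitive_from p (primitive_from p (g w)) y - primitive_from p (primitive_from p (g v)) y\<bar> / W y"
      using W(2)[of y]
      by (simp add: P_def dist_real_def diff_divide_distrib[symmetric] abs_minus_commute)
    also have "\<dots> \<le> M * dist w v / K / K"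
      using d2 W(2)[of y] by (simp add: pos_divide_le_eq)
    also have "\<dots> = M / (K * K) * dist w v" by simp
    also have "\<dots> \<le> 1/2 * dist w v"
    proof (rule mult_right_mono)
      have "2 * M \<le> K * K" using M by (simp add: K_def algebra_simps)
      then show "M / (K * K) \<le> 1/2" using K(2) by (simp add: pos_divide_le_eq)
    qed simp
    finally show "dist (apply_bcontfun (\<Phi> w) y) (apply_bcontfun (\<Phi> v) y) \<le> 1/2 * dist w v"
      by (simp add: \<Phi>)
  qed
  obtain w where w: "\<Phi> w = w"
    using banach_fix_type[of "1/2" \<Phi>] contr by auto
  define f where "f y = W y * apply_bcontfun w y" for y
  show ?thesis
  proof
    show "continuous_on UNIV f" unfolding f_def by (intro continuous_intros W) auto
    have gf: "g w = (\<lambda>s. q s * f s)" by (simp add: g_def f_def fun_eq_iff)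
    fix y
    have "f y = W y * P w y" using \<Phi>[of w] w by (simp add: f_def)
    then show "f y = a + b * (y - p) - primitive_from p (primitive_from p (\<lambda>s. q s * f s)) y"
      using W(2)[of y] by (simp add: P_def gf)
  qed
qed

text \<open>
  A discontinuous \<open>q\<close> leaves \<open>f'\<close> only locally Lipschitz, which is what will give local absolute
  continuity; the second derivative exists wherever \<open>q\<close> is continuous.
\<close>

lemma linear_ivp:
  fixes q :: "real \<Rightarrow> real"
  assumes q: "q \<in> borel_measurable borel" and qM: "\<And>y. \<bar>q y\<bar> \<le> M"
  obtains f f' where "f p = a" "f' p = b"
    "\<And>y. (f has_real_derivative f' y) (at y)"
    "\<And>y. isCont q y \<Longrightarrow> (f' has_real_derivative - (q y * f y)) (at y)"
    "\<And>A B. \<exists>L. \<forall>s t. A \<le> s \<longrightarrow> s \<le> t \<longrightarrow> t \<le> B \<longrightarrow> \<bar>f' t - f' s\<bar> \<le> L * (t - s)"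
    "continuous_on UNIV f'"
proof -
  obtain f where fc: "continuous_on UNIV f"
    and f: "\<And>y. f y = a + b * (y - p) - primitive_from p (primitive_from p (\<lambda>s. q s * f s)) y"
    using volterra_fixed_point[OF q qM] by blast
  define J where "J = primitive_from p (\<lambda>s. q s * f s)"
  have M: "0 \<le> M" using qM[of 0] by linarith
  have b1: "\<bar>q s * f s\<bar> \<le> M * \<bar>f s\<bar>" for s
    using qM[of s] by (simp add: abs_mult mult_right_mono)
  have c1: "continuous_on UNIV (\<lambda>s. M * \<bar>f s\<bar>)" by (intro continuous_intros fc)
  have i1: "locally_integrable (\<lambda>s. q s * f s)"
    by (rule locally_integrable_bounded[OF _ c1 b1])
       (intro borel_measurable_times q borel_measurable_continuous_onI fc)
  have Jc: "continuous_on UNIV J" unfolding J_def by (rule primitive_from_continuous[OF i1])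
  have iJ: "locally_integrable J"
    using Jc by (auto simp: locally_integrable_def intro!: integrable_continuous_interval intro: continuous_on_subset)
  have dJ: "(primitive_from p J has_real_derivative J y) (at y)" for y
    by (rule primitive_from_has_derivative[OF iJ]) (use Jc in \<open>auto simp: continuous_on_eq_continuous_at\<close>)
  show ?thesis
  proof
    show "f p = a" using f[of p] by simp
    show "b - J p = b" by (simp add: J_def)
    show "continuous_on UNIV (\<lambda>y. b - J y)" by (intro continuous_intros Jc)
    show "(f has_real_derivative b - J y) (at y)" for y
    proof -
      have "f = (\<lambda>y. a + b * (y - p) - primitive_from p J y)"
        unfolding J_def by (rule ext) (rule f)
      then show ?thesis by (auto intro!: derivative_eq_intros dJ)
    qed
    show "((\<lambda>y. b - J y) has_real_derivative - (q y * f y)) (at y)" if "isCont q y" for y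
    proof -
      have "isCont (\<lambda>s. q s * f s) y"
        using that fc by (auto intro!: continuous_intros simp: continuous_on_eq_continuous_at)
      from primitive_from_has_derivative[OF i1 this, of p] show ?thesis
        unfolding J_def by (auto intro!: derivative_eq_intros)
    qed
    show "\<exists>L. \<forall>s t. A \<le> s \<longrightarrow> s \<le> t \<longrightarrow> t \<le> B \<longrightarrow> \<bar>(b - J t) - (b - J s)\<bar> \<le> L * (t - s)" for A B
    proof -
      have "bounded ((\<lambda>s. M * \<bar>f s\<bar>) ` {A..B})"
        by (intro compact_imp_bounded compact_continuous_image continuous_on_subset[OF c1]) auto
      then obtain L where "\<And>s. s \<in> {A..B} \<Longrightarrow> norm (M * \<bar>f s\<bar>) \<le> L"
        unfolding bounded_iff by blast
      then have L: "M * \<bar>f s\<bar> \<le> L" if "s \<in> {A..B}" for s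
        using that order_trans[OF abs_ge_self] by (metis real_norm_def)
      have "\<bar>J t - J s\<bar> \<le> L * (t - s)" if "A \<le> s" "s \<le> t" "t \<le> B" for s t
        unfolding J_def
      proof (rule primitive_from_lipschitz[OF i1 _ that(2)])
        fix z assume "z \<in> {s..t}"
        then have "M * \<bar>f z\<bar> \<le> L" using that by (intro L) auto
        then show "\<bar>q z * f z\<bar> \<le> L" by (rule order_trans[OF b1])
      qed
      then show ?thesis by (intro exI[of _ L]) (auto simp: abs_minus_commute)
    qed
  qed
qed

section \<open>Solutions in a medium with a defect\<close>

lemma is_solution_derivatives:
  assumes "is_solution c \<omega> u"
  shows "(u has_vector_derivative D\<^sub>x u y) (at y)"
    and "continuous_on UNIV (D\<^sub>x u)"
    and "isCont c y \<Longrightarrow> (D\<^sub>x u has_vector_derivative - (of_real (\<omega>\<^sup>2 / (c y)\<^sup>2) * u y)) (at y)"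
proof -
  show "(u has_vector_derivative D\<^sub>x u y) (at y)" "continuous_on UNIV (D\<^sub>x u)"
    using assms by (auto simp: is_solution_def C1_differentiable_on_eq vector_derivative_works)
  show "(D\<^sub>x u has_vector_derivative - (of_real (\<omega>\<^sup>2 / (c y)\<^sup>2) * u y)) (at y)" if "isCont c y"
  proof -
    have "D\<^sub>x u differentiable (at y)"
      and e: "vector_derivative (D\<^sub>x u) (at y) + of_real (\<omega>\<^sup>2 / (c y)\<^sup>2) * u y = 0"
      using assms that by (auto simp: is_solution_def)
    then have "(D\<^sub>x u has_vector_derivative vector_derivative (D\<^sub>x u) (at y)) (at y)"
      by (simp add: vector_derivative_works)
    then show ?thesis using e by (simp add: add_eq_0_iff2)
  qed
qed

text \<open>
  This finite exceptional set is what makes the fundamental theorem of calculus applicable to the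
  derivative of a solution.
\<close>

lemma piecewise_smooth_finite_discontinuities:
  assumes "piecewise_smooth c"
  shows "finite ({a<..<b} \<inter> {y. \<not> isCont c y})"
proof -
  obtain S where S: "finite S" "\<forall>y \<in> {a<..<b} - S. \<forall>k::nat. ((deriv ^^ k) c) differentiable (at y)"
    using assms unfolding piecewise_smooth_def by blast
  have "isCont c y" if "y \<in> {a<..<b} - S" for y
    using S(2)[rule_format, OF that, of 0] by (simp add: differentiable_imp_continuous_within)
  then have "{a<..<b} \<inter> {y. \<not> isCont c y} \<subseteq> S" by blast
  then show ?thesis using S(1) finite_subset by blast
qed

lemma piecewise_smooth_borel_measurable:
  assumes "piecewise_smooth c"
  shows "c \<in> borel_measurable borel"
proof (rule borel_measurable_continuous_countable_exceptions)
  have "{y. \<not> isCont c y} \<subseteq> (\<Union>n::nat. {- real n<..<real n} \<inter> {y. \<not> isCont c y})"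
  proof
    fix y assume "y \<in> {y. \<not> isCont c y}"
    moreover obtain n where "\<bar>y\<bar> < real n" using reals_Archimedean2 by blast
    then have "y \<in> {- real n<..<real n}" by auto
    ultimately show "y \<in> (\<Union>n::nat. {- real n<..<real n} \<inter> {y. \<not> isCont c y})" by blast
  qed
  moreover have "countable (\<Union>n::nat. {- real n<..<real n} \<inter> {y. \<not> isCont c y})"
    by (rule countable_UN[OF countableI_type])
       (rule countable_finite[OF piecewise_smooth_finite_discontinuities[OF assms]])
  ultimately show "countable {y. \<not> isCont c y}" by (rule countable_subset)
  show "continuous_on (- {y. \<not> isCont c y}) c"
    by (auto intro!: continuous_at_imp_continuous_on)
qed

text \<open>
  The positive one-sided limits, together with the positive value at the point itself, bound \<open>c\<close>
  from below near every point; compactness makes the bound uniform.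
\<close>

lemma piecewise_smooth_bounded_below_on_compact:
  assumes ps: "piecewise_smooth c" and pos: "\<And>y. c y > 0"
  obtains m where "m > 0" "\<And>y. y \<in> {A..B} \<Longrightarrow> m \<le> c y"
proof -
  have loc: "\<exists>e>0. \<exists>U. open U \<and> y \<in> U \<and> (\<forall>z\<in>U. e \<le> c z)" for y
  proof -
    obtain l r where lr: "l > 0" "(c \<longlongrightarrow> l) (at_left y)" "r > 0" "(c \<longlongrightarrow> r) (at_right y)"
      using ps unfolding piecewise_smooth_def by blast
    define e where "e = min (c y) (min (l/2) (r/2))"
    have e: "e > 0" "e < l" "e < r" "e \<le> c y" using lr pos[of y] by (auto simp: e_def)
    have "eventually (\<lambda>z. e < c z) (at_left y)" "eventually (\<lambda>z. e < c z) (at_right y)"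
      using order_tendstoD(1)[OF lr(2) e(2)] order_tendstoD(1)[OF lr(4) e(3)] by auto
    then have "eventually (\<lambda>z. e < c z) (at y)" by (simp add: eventually_at_split)
    then have "eventually (\<lambda>z. z \<noteq> y \<longrightarrow> e < c z) (nhds y)" by (simp add: eventually_at_filter)
    then obtain U where "open U" "y \<in> U" "\<forall>z\<in>U. z \<noteq> y \<longrightarrow> e < c z"
      by (auto simp: eventually_nhds)
    then show ?thesis using e by (intro exI[of _ e] conjI exI[of _ U]) (auto intro: less_imp_le)
  qed
  obtain e U where eU: "\<And>y. e y > 0" "\<And>y. open (U y)" "\<And>y. y \<in> U y" "\<And>y z. z \<in> U y \<Longrightarrow> e y \<le> (c z :: real)"
    using loc by metis
  have "{A..B} \<subseteq> (\<Union>y\<in>{A..B}. U y)" using eU(3) by blast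
  then obtain F where F: "F \<subseteq> {A..B}" "finite F" "{A..B} \<subseteq> (\<Union>y\<in>F. U y)"
    using compactE_image[of "{A..B}" "{A..B}" U] eU(2) compact_Icc by metis
  define m where "m = Min (insert 1 (e ` F))"
  show ?thesis
  proof
    show "m > 0" unfolding m_def using F(2) eU(1) by (subst Min_gr_iff) auto
    fix y assume "y \<in> {A..B}"
    then obtain z where z: "z \<in> F" "y \<in> U z" using F(3) by blast
    then have "m \<le> e z" unfolding m_def using F(2) by (intro Min_le) auto
    also have "\<dots> \<le> c y" using eU(4) z by blast
    finally show "m \<le> c y" .
  qed
qed

lemma defect_medium_nodes:
  assumes "defect_medium h x c"
  shows "x (1 + int k) = x 1 + real k * h" and "x (- int k) = x 0 - real k * h"
proof -
  have step: "x (n + 1) = x n + h" if "n \<noteq> 0" for n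
  proof -
    have "x (n + 1) - x n = h" using assms that unfolding defect_medium_def by blast
    then show ?thesis by simp
  qed
  show "x (1 + int k) = x 1 + real k * h"
  proof (induction k)
    case (Suc k)
    show ?case using step[of "1 + int k"] Suc by (simp add: algebra_simps)
  qed simp
  show "x (- int k) = x 0 - real k * h"
  proof (induction k)
    case (Suc k)
    have "- int (Suc k) + 1 = - int k" by simp
    then show ?case using step[of "- int (Suc k)"] Suc by (simp add: algebra_simps)
  qed simp
qed

text \<open>
  The interval \<open>[x\<^sub>0, x\<^sub>1 + h]\<close> contains the defect and one full cell.  A bound there extends to the
  whole line by periodicity, once every point outside the defect is placed in a cell.
\<close>

lemma defect_medium_bounded_below:
  assumes dm: "defect_medium h x c"
  obtains m where "m > 0" "\<And>y. m \<le> c y"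
proof -
  have h: "h > 0" and x01: "x 0 < x 1" and pos: "\<And>y. c y > 0" and ps: "piecewise_smooth c"
    using dm by (simp_all add: defect_medium_def)
  have per: "\<forall>n m. \<forall>t\<in>{0..<h}. n \<noteq> 0 \<longrightarrow> m \<noteq> 0 \<longrightarrow> c (x n + t) = c (x m + t)"
    using dm unfolding defect_medium_def by (elim conjE)
  obtain m where m: "m > 0" "\<And>y. y \<in> {x 0..x 1 + h} \<Longrightarrow> m \<le> c y"
    using piecewise_smooth_bounded_below_on_compact[OF ps pos] by blast
  have cell: "m \<le> c (x n + t)" if "n \<noteq> 0" "t \<in> {0..<h}" for n t
    using per[rule_format, OF that(2,1), of 1] m(2)[of "x 1 + t"] that x01 by auto
  have "m \<le> c y" for y
  proof -
    consider "x 1 \<le> y" | "y < x 0" | "x 0 \<le> y" "y \<le> x 1" by linarith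
    then show ?thesis
    proof cases
      case 1
      define k where "k = nat \<lfloor>(y - x 1) / h\<rfloor>"
      have k: "real k = of_int \<lfloor>(y - x 1) / h\<rfloor>" using 1 h by (simp add: k_def)
      have "real k \<le> (y - x 1) / h" "(y - x 1) / h < real k + 1" unfolding k by linarith+
      then have "y - x (1 + int k) \<in> {0..<h}"
        using h by (simp add: defect_medium_nodes(1)[OF dm] field_simps)
      then show ?thesis using cell[of "1 + int k" "y - x (1 + int k)"] by simp
    next
      case 2
      define k where "k = nat \<lceil>(x 0 - y) / h\<rceil>"
      have p: "(x 0 - y) / h > 0" using 2 h by simp
      then have k: "real k = of_int \<lceil>(x 0 - y) / h\<rceil>" by (simp add: k_def)
      have k1: "(x 0 - y) / h \<le> real k" "real k < (x 0 - y) / h + 1" unfolding k by linarith+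
      then have "y - x (- int k) \<in> {0..<h}"
        using h by (simp add: defect_medium_nodes(2)[OF dm] field_simps)
      moreover have "k \<noteq> 0" using k1(1) p by auto
      ultimately show ?thesis using cell[of "- int k" "y - x (- int k)"] by simp
    next
      case 3
      then show ?thesis using m(2)[of y] h by auto
    qed
  qed
  then show ?thesis using that m(1) by blast
qed

lemma locally_lipschitz_imp_locally_abs_continuous:
  fixes f :: "real \<Rightarrow> 'a::real_normed_vector"
  assumes lip: "\<And>A B. \<exists>L. \<forall>s t. A \<le> s \<longrightarrow> s \<le> t \<longrightarrow> t \<le> B \<longrightarrow> norm (f t - f s) \<le> L * (t - s)"
  shows "locally_abs_continuous f"
  unfolding locally_abs_continuous_def abs_continuous_on_def
proof (intro allI impI)
  fix A B \<epsilon> :: real assume \<epsilon>: "\<epsilon> > 0"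
  obtain L where L: "\<And>s t. A \<le> s \<Longrightarrow> s \<le> t \<Longrightarrow> t \<le> B \<Longrightarrow> norm (f t - f s) \<le> L * (t - s)"
    using lip[of A B] by blast
  show "\<exists>\<delta>>0. \<forall>P. finite P \<longrightarrow> (\<forall>(s, t) \<in> P. s \<le> t \<and> {s..t} \<subseteq> {A..B}) \<longrightarrow>
      pairwise (\<lambda>(s, t) (s', t'). {s<..<t} \<inter> {s'<..<t'} = {}) P \<longrightarrow>
      (\<Sum>(s, t)\<in>P. t - s) < \<delta> \<longrightarrow> (\<Sum>(s, t)\<in>P. norm (f t - f s)) < \<epsilon>"
  proof (intro exI[of _ "\<epsilon> / (\<bar>L\<bar> + 1)"] conjI allI impI)
    show "\<epsilon> / (\<bar>L\<bar> + 1) > 0" using \<epsilon> by (simp add: add_nonneg_pos)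
    fix P assume P: "finite P" "\<forall>(s, t) \<in> P. s \<le> t \<and> {s..t} \<subseteq> {A..B}"
      and small: "(\<Sum>(s, t)\<in>P. t - s) < \<epsilon> / (\<bar>L\<bar> + 1)"
    have "(\<Sum>(s, t)\<in>P. norm (f t - f s)) \<le> (\<Sum>(s, t)\<in>P. (\<bar>L\<bar> + 1) * (t - s))"
    proof (rule sum_mono, clarsimp)
      fix s t assume "(s, t) \<in> P"
      then have st: "A \<le> s" "s \<le> t" "t \<le> B" using P(2) by auto
      have "L * (t - s) \<le> (\<bar>L\<bar> + 1) * (t - s)" using st by (intro mult_right_mono) auto
      then show "norm (f t - f s) \<le> (\<bar>L\<bar> + 1) * (t - s)" using L[OF st] by linarith
    qed
    also have "\<dots> = (\<bar>L\<bar> + 1) * (\<Sum>(s, t)\<in>P. t - s)"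
      by (simp add: sum_distrib_left case_prod_beta)
    also have "\<dots> < \<epsilon>" using small by (simp add: pos_less_divide_eq add_nonneg_pos mult.commute)
    finally show "(\<Sum>(s, t)\<in>P. norm (f t - f s)) < \<epsilon>" .
  qed
qed

lemma solution_exists:
  assumes ps: "piecewise_smooth c" and m: "m > 0" "\<And>y. m \<le> c y" and ab: "a \<noteq> 0 \<or> b \<noteq> 0"
  obtains u where "is_solution c \<omega> u" "u p = of_real a" "D\<^sub>x u p = of_real b"
proof -
  define q where "q y = \<omega>\<^sup>2 / (c y)\<^sup>2" for y
  have pos: "c y > 0" for y using m(1) m(2)[of y] by linarith
  have "\<bar>q y\<bar> \<le> \<omega>\<^sup>2 / m\<^sup>2" for y
    using m(1) m(2)[of y] pos[of y] by (auto simp: q_def intro!: divide_left_mono power_mono)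
  moreover have "q \<in> borel_measurable borel"
    unfolding q_def using piecewise_smooth_borel_measurable[OF ps] by measurable
  ultimately obtain f f' where f: "f p = a" "f' p = b"
    "\<And>y. (f has_real_derivative f' y) (at y)"
    "\<And>y. isCont q y \<Longrightarrow> (f' has_real_derivative - (q y * f y)) (at y)"
    "\<And>A B. \<exists>L. \<forall>s t. A \<le> s \<longrightarrow> s \<le> t \<longrightarrow> t \<le> B \<longrightarrow> \<bar>f' t - f' s\<bar> \<le> L * (t - s)"
    "continuous_on UNIV f'"
    using linear_ivp[of q _ p a b] by metis
  define u where "u y = complex_of_real (f y)" for y
  have u': "(u has_vector_derivative of_real (f' y)) (at y)" for y
    unfolding u_def using f(3) by (intro has_vector_derivative_of_real) (simp add: has_real_derivative_iff_has_vector_derivative)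
  have Du: "D\<^sub>x u = (\<lambda>y. of_real (f' y))"
    using u' by (auto simp: fun_eq_iff intro: vector_derivative_at)
  have u'': "(D\<^sub>x u has_vector_derivative - (of_real (\<omega>\<^sup>2 / (c y)\<^sup>2) * u y)) (at y)" if "isCont c y" for y
  proof -
    have "isCont q y" unfolding q_def using that pos[of y] by (intro continuous_intros) auto
    from f(4)[OF this] have "((\<lambda>y. complex_of_real (f' y)) has_vector_derivative of_real (- (q y * f y))) (at y)"
      by (intro has_vector_derivative_of_real) (simp add: has_real_derivative_iff_has_vector_derivative)
    then show ?thesis by (simp add: Du q_def u_def)
  qed
  have "is_solution c \<omega> u"
    unfolding is_solution_def
  proof (intro conjI allI impI)
    show "\<exists>y. u y \<noteq> 0"
    proof (rule ccontr)
      assume "\<nexists>y. u y \<noteq> 0"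
      then have z: "f = (\<lambda>_. 0)" by (auto simp: u_def)
      have "f' p = 0" using f(3)[of p] unfolding z by (intro DERIV_unique[OF _ DERIV_const])
      then show False using z f(1,2) ab by auto
    qed
    show "u C1_differentiable_on UNIV"
      unfolding C1_differentiable_on_def using u' f(6)
      by (intro exI[of _ "\<lambda>y. of_real (f' y)"]) (auto intro!: continuous_intros)
    show "locally_abs_continuous (D\<^sub>x u)"
      unfolding Du
    proof (rule locally_lipschitz_imp_locally_abs_continuous)
      fix A B
      have "norm (complex_of_real (f' t) - of_real (f' s)) = \<bar>f' t - f' s\<bar>" for s t
        by (metis norm_of_real of_real_diff)
      then show "\<exists>L. \<forall>s t. A \<le> s \<longrightarrow> s \<le> t \<longrightarrow> t \<le> B \<longrightarrow>
          norm (complex_of_real (f' t) - of_real (f' s)) \<le> L * (t - s)"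
        using f(5)[of A B] by simp
    qed
    fix y assume "isCont c y"
    note d = u''[OF this]
    show "D\<^sub>x u differentiable (at y)" using d by (rule differentiableI_vector)
    show "vector_derivative (D\<^sub>x u) (at y) + of_real (\<omega>\<^sup>2 / (c y)\<^sup>2) * u y = 0"
      using vector_derivative_at[OF d] by simp
  qed
  then show ?thesis using that[of u] f(1,2) by (simp add: fun_cong[OF Du, of p] u_def)
qed

text \<open>
  In the derivative of the Wronskian both second derivatives carry the same factor \<open>- \<omega>\<^sup>2 / c\<^sup>2\<close>, so
  it vanishes off the finitely many discontinuities of \<open>c\<close> in the interval.
\<close>

lemma wronskian_constant:
  assumes ps: "piecewise_smooth c" and u: "is_solution c \<omega> u" and v: "is_solution c \<omega> v" and ab: "a \<le> b"
  shows "u b * D\<^sub>x v b - D\<^sub>x u b * v b = u a * D\<^sub>x v a - D\<^sub>x u a * v a"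
proof -
  let ?W = "\<lambda>y. u y * D\<^sub>x v y - D\<^sub>x u y * v y"
  note du = is_solution_derivatives[OF u] and dv = is_solution_derivatives[OF v]
  have cont: "continuous_on {a..b} u" "continuous_on {a..b} v"
    using du(1) dv(1) by (meson continuous_at_imp_continuous_on has_vector_derivative_continuous)+
  have "((\<lambda>_. 0) has_integral ?W b - ?W a) {a..b}"
  proof (rule fundamental_theorem_of_calculus_interior_strong[OF piecewise_smooth_finite_discontinuities[OF ps, of a b] ab])
    show "continuous_on {a..b} ?W"
      by (intro continuous_intros cont continuous_on_subset[OF du(2)] continuous_on_subset[OF dv(2)]) auto
    fix y assume "y \<in> {a<..<b} - {a<..<b} \<inter> {y. \<not> isCont c y}"
    then have y: "isCont c y" by blast
    let ?q = "complex_of_real (\<omega>\<^sup>2 / (c y)\<^sup>2)"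
    have "(?W has_vector_derivative
        (u y * - (?q * v y) + D\<^sub>x u y * D\<^sub>x v y) - (D\<^sub>x u y * D\<^sub>x v y + - (?q * u y) * v y)) (at y)"
      by (intro has_vector_derivative_diff has_vector_derivative_mult du(1) dv(1) du(3)[OF y] dv(3)[OF y])
    then show "(?W has_vector_derivative 0) (at y)" by (simp add: algebra_simps)
  qed
  then have "?W b - ?W a = 0" by (rule has_integral_unique) simp
  then show ?thesis by simp
qed

text \<open>
  On \<open>[y, y + 1]\<close> the derivative varies by at most \<open>\<omega>\<^sup>2 / m\<^sup>2 * \<epsilon>\<close>, since \<open>u'' = - (\<omega>\<^sup>2 / c\<^sup>2) u\<close>.  So
  \<open>u' (y)\<close> differs by at most that much from its mean \<open>u (y + 1) - u (y)\<close>, whose norm is at most \<open>2 * \<epsilon>\<close>.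
\<close>

lemma derivative_norm_le_of_solution_norm_le:
  assumes ps: "piecewise_smooth c" and m: "m > 0" "\<And>y. m \<le> c y" and u: "is_solution c \<omega> u"
    and small: "\<And>s. s \<in> {y..y+1} \<Longrightarrow> norm (u s) \<le> \<epsilon>"
  shows "norm (D\<^sub>x u y) \<le> (2 + \<omega>\<^sup>2 / m\<^sup>2) * \<epsilon>"
proof -
  note du = is_solution_derivatives[OF u]
  let ?M = "\<omega>\<^sup>2 / m\<^sup>2"
  have \<epsilon>: "0 \<le> \<epsilon>" using order_trans[OF norm_ge_zero small[of y]] by simp
  have q: "\<bar>\<omega>\<^sup>2 / (c s)\<^sup>2\<bar> \<le> ?M" for s
    using m(1) m(2)[of s] by (auto intro!: divide_left_mono power_mono mult_pos_pos zero_less_power)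
  have var: "norm (D\<^sub>x u t - D\<^sub>x u y) \<le> ?M * \<epsilon>" if t: "t \<in> {y..y+1}" for t
  proof -
    have yt: "y \<le> t" using t by simp
    have "((\<lambda>s. - (of_real (\<omega>\<^sup>2 / (c s)\<^sup>2) * u s)) has_integral D\<^sub>x u t - D\<^sub>x u y) {y..t}"
      by (rule fundamental_theorem_of_calculus_interior_strong
            [OF piecewise_smooth_finite_discontinuities[OF ps, of y t] yt])
         (use du in \<open>auto intro: continuous_on_subset\<close>)
    then have "((\<lambda>s. - (of_real (\<omega>\<^sup>2 / (c s)\<^sup>2) * u s)) has_integral D\<^sub>x u t - D\<^sub>x u y) (cbox y t)" by simp
    then have "norm (D\<^sub>x u t - D\<^sub>x u y) \<le> ?M * \<epsilon> * measure lborel (cbox y t)"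
    proof (rule has_integral_bound[rotated])
      show "0 \<le> ?M * \<epsilon>" using \<epsilon> by simp
      fix s assume "s \<in> cbox y t"
      then have s: "s \<in> {y..y+1}" using t by auto
      have "norm (- (complex_of_real (\<omega>\<^sup>2 / (c s)\<^sup>2) * u s)) = \<bar>\<omega>\<^sup>2 / (c s)\<^sup>2\<bar> * norm (u s)"
        by (simp only: norm_minus_cancel norm_mult norm_of_real)
      also have "\<dots> \<le> ?M * \<epsilon>" by (rule mult_mono[OF q small[OF s]]) auto
      finally show "norm (- (complex_of_real (\<omega>\<^sup>2 / (c s)\<^sup>2) * u s)) \<le> ?M * \<epsilon>" .
    qed
    also have "\<dots> \<le> ?M * \<epsilon> * 1" using t \<epsilon> by (intro mult_left_mono) auto
    finally show ?thesis by simp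
  qed
  have i1: "((\<lambda>t. D\<^sub>x u t) has_integral u (y+1) - u y) {y..y+1}"
    using du(1) by (intro fundamental_theorem_of_calculus) (auto intro: has_vector_derivative_at_within)
  have i2: "((\<lambda>t. D\<^sub>x u y) has_integral D\<^sub>x u y) {y..y+1}"
    using has_integral_const_real[of "D\<^sub>x u y" y "y+1"] by simp
  have "((\<lambda>t. D\<^sub>x u t - D\<^sub>x u y) has_integral u (y+1) - u y - D\<^sub>x u y) (cbox y (y+1))"
    using Henstock_Kurzweil_Integration.has_integral_diff[OF i1 i2] by simp
  then have "norm (u (y+1) - u y - D\<^sub>x u y) \<le> ?M * \<epsilon> * measure lborel (cbox y (y+1))"
    by (rule has_integral_bound[rotated]) (use \<epsilon> var in auto)
  then have "norm (u (y+1) - u y - D\<^sub>x u y) \<le> ?M * \<epsilon>" by simp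
  moreover have "norm (D\<^sub>x u y) \<le> norm (u (y+1)) + norm (u y) + norm (u (y+1) - u y - D\<^sub>x u y)"
    using norm_triangle_ineq4[of "u (y+1) - u y" "u (y+1) - u y - D\<^sub>x u y"]
      norm_triangle_ineq4[of "u (y+1)" "u y"] by simp
  ultimately show ?thesis using small[of y] small[of "y+1"] by (simp add: algebra_simps)
qed

lemma derivative_tendsto_zero:
  assumes ps: "piecewise_smooth c" and m: "m > 0" "\<And>y. m \<le> c y" and u: "is_solution c \<omega> u"
  shows "(u \<longlongrightarrow> 0) at_top \<Longrightarrow> (D\<^sub>x u \<longlongrightarrow> 0) at_top"
    and "(u \<longlongrightarrow> 0) at_bot \<Longrightarrow> (D\<^sub>x u \<longlongrightarrow> 0) at_bot"
proof -
  let ?C = "2 + \<omega>\<^sup>2 / m\<^sup>2"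
  have C: "?C > 0" by (simp add: add_pos_nonneg)
  note bound = derivative_norm_le_of_solution_norm_le[OF ps m u]
  have small: "norm (D\<^sub>x u y) < e"
    if e: "e > 0" and s: "\<And>s. s \<in> {y..y+1} \<Longrightarrow> norm (u s) < e / (2 * ?C)" for e y
  proof -
    have "norm (D\<^sub>x u y) \<le> ?C * (e / (2 * ?C))" by (rule bound) (use s in \<open>auto intro: less_imp_le\<close>)
    also have "\<dots> = e / 2" using C by (simp add: field_simps)
    also have "\<dots> < e" using e by simp
    finally show ?thesis .
  qed
  show "(D\<^sub>x u \<longlongrightarrow> 0) at_top" if "(u \<longlongrightarrow> 0) at_top"
  proof (rule tendstoI)
    fix e :: real assume e: "e > 0"
    then have "e / (2 * ?C) > 0" using C by simp
    from tendstoD[OF that this] obtain N where N: "\<And>s. s \<ge> N \<Longrightarrow> norm (u s) < e / (2 * ?C)"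
      by (auto simp: eventually_at_top_linorder)
    have "norm (D\<^sub>x u y) < e" if "y \<ge> N" for y by (rule small[OF e N]) (use that in auto)
    then show "eventually (\<lambda>y. dist (D\<^sub>x u y) 0 < e) at_top"
      by (auto simp: eventually_at_top_linorder)
  qed
  show "(D\<^sub>x u \<longlongrightarrow> 0) at_bot" if "(u \<longlongrightarrow> 0) at_bot"
  proof (rule tendstoI)
    fix e :: real assume e: "e > 0"
    then have "e / (2 * ?C) > 0" using C by simp
    from tendstoD[OF that this] obtain N where N: "\<And>s. s \<le> N \<Longrightarrow> norm (u s) < e / (2 * ?C)"
      by (auto simp: eventually_at_bot_linorder)
    have "norm (D\<^sub>x u y) < e" if "y \<le> N - 1" for y by (rule small[OF e N]) (use that in auto)
    then show "eventually (\<lambda>y. dist (D\<^sub>x u y) 0 < e) at_bot"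
      by (auto simp: eventually_at_bot_linorder)
  qed
qed

lemma localised_eigenmode_nodes_tendsto_zero:
  assumes dm: "defect_medium h x c" and eig: "localised_eigenmode c \<omega> u"
  shows "(\<lambda>k. u (x (1 + int k))) \<longlonglongrightarrow> 0" and "(\<lambda>k. u (x (- int k))) \<longlonglongrightarrow> 0"
    and "(\<lambda>k. D\<^sub>x u (x (1 + int k))) \<longlonglongrightarrow> 0" and "(\<lambda>k. D\<^sub>x u (x (- int k))) \<longlonglongrightarrow> 0"
proof -
  have u: "is_solution c \<omega> u" and lim: "(u \<longlongrightarrow> 0) at_top" "(u \<longlongrightarrow> 0) at_bot"
    using eig by (auto simp: localised_eigenmode_def)
  have h: "h > 0" and ps: "piecewise_smooth c" using dm by (auto simp: defect_medium_def)
  obtain m where m: "m > 0" "\<And>y. m \<le> c y" using defect_medium_bounded_below[OF dm] by blast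
  note lim' = derivative_tendsto_zero[OF ps m u]
  have unbounded: "filterlim (\<lambda>k. a + real k * h) at_top sequentially" for a
    by (intro filterlim_tendsto_add_at_top[OF tendsto_const]
          filterlim_at_top_mult_tendsto_pos[OF tendsto_const h filterlim_real_sequentially])
  have top: "filterlim (\<lambda>k. x (1 + int k)) at_top sequentially"
    unfolding defect_medium_nodes(1)[OF dm] by (rule unbounded)
  have bot: "filterlim (\<lambda>k. x (- int k)) at_bot sequentially"
    using unbounded[of "- x 0"] unfolding defect_medium_nodes(2)[OF dm] filterlim_uminus_at_top by simp
  show "(\<lambda>k. u (x (1 + int k))) \<longlonglongrightarrow> 0" by (rule filterlim_compose[OF lim(1) top])
  show "(\<lambda>k. u (x (- int k))) \<longlonglongrightarrow> 0" by (rule filterlim_compose[OF lim(2) bot])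
  show "(\<lambda>k. D\<^sub>x u (x (1 + int k))) \<longlonglongrightarrow> 0" by (rule filterlim_compose[OF lim'(1)[OF lim(1)] top])
  show "(\<lambda>k. D\<^sub>x u (x (- int k))) \<longlonglongrightarrow> 0" by (rule filterlim_compose[OF lim'(2)[OF lim(2)] bot])
qed

section \<open>The transfer matrix and its recurrence\<close>

lemma transfer_matrix_components:
  assumes "is_transfer_matrix x c \<omega> T" "is_solution c \<omega> u" "n \<noteq> 0"
  shows "u (x (n + 1)) = of_real (T$1$1) * u (x n) + of_real (T$1$2) * D\<^sub>x u (x n)"
    and "D\<^sub>x u (x (n + 1)) = of_real (T$2$1) * u (x n) + of_real (T$2$2) * D\<^sub>x u (x n)"
proof -
  have e: "(vector [u (x (n + 1)), D\<^sub>x u (x (n + 1))] :: complex^2) =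
      map_matrix of_real T *v vector [u (x n), D\<^sub>x u (x n)]"
    using assms unfolding is_transfer_matrix_def by blast
  show "u (x (n + 1)) = of_real (T$1$1) * u (x n) + of_real (T$1$2) * D\<^sub>x u (x n)"
    using arg_cong[OF e, of "\<lambda>v. v $ 1"] by (simp add: matrix_vector_mult_def sum_2)
  show "D\<^sub>x u (x (n + 1)) = of_real (T$2$1) * u (x n) + of_real (T$2$2) * D\<^sub>x u (x n)"
    using arg_cong[OF e, of "\<lambda>v. v $ 2"] by (simp add: matrix_vector_mult_def sum_2)
qed

text \<open>
  The solutions with Cauchy data \<open>(1, 0)\<close> and \<open>(0, 1)\<close> at \<open>x\<^sub>1\<close> have the columns of \<open>T\<close> as Cauchy data
  at \<open>x\<^sub>2\<close>.  So the determinant of \<open>T\<close> is their Wronskian at \<open>x\<^sub>2\<close>, which equals the one at \<open>x\<^sub>1\<close>.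
\<close>

lemma transfer_matrix_det:
  assumes dm: "defect_medium h x c" and T: "is_transfer_matrix x c \<omega> T"
  shows "T$1$1 * T$2$2 - T$1$2 * T$2$1 = 1"
proof -
  have ps: "piecewise_smooth c" and h: "h > 0" and x2: "x 2 = x 1 + h"
    using dm defect_medium_nodes(1)[OF dm, of 1] by (auto simp: defect_medium_def)
  obtain m where m: "m > 0" "\<And>y. m \<le> c y" using defect_medium_bounded_below[OF dm] by blast
  obtain u where u: "is_solution c \<omega> u" "u (x 1) = of_real 1" "D\<^sub>x u (x 1) = of_real 0"
    using solution_exists[OF ps m, of 1 0] by auto
  obtain v where v: "is_solution c \<omega> v" "v (x 1) = of_real 0" "D\<^sub>x v (x 1) = of_real 1"
    using solution_exists[OF ps m, of 0 1] by auto
  have "u (x 2) * D\<^sub>x v (x 2) - D\<^sub>x u (x 2) * v (x 2) = 1"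
    using wronskian_constant[OF ps u(1) v(1), of "x 1" "x 2"] h u v by (simp add: x2)
  moreover have "u (x 2) = of_real (T$1$1)" "D\<^sub>x u (x 2) = of_real (T$2$1)"
    "v (x 2) = of_real (T$1$2)" "D\<^sub>x v (x 2) = of_real (T$2$2)"
    using transfer_matrix_components[OF T u(1), of 1] transfer_matrix_components[OF T v(1), of 1] u v
    by simp_all
  ultimately have "complex_of_real (T$1$1 * T$2$2 - T$1$2 * T$2$1) = of_real 1"
    by (simp add: mult.commute)
  then show ?thesis by (simp only: of_real_eq_iff)
qed

lemma eigenvalue_characteristic_equation:
  assumes "is_eigenvalue T l"
  shows "l\<^sup>2 - (T$1$1 + T$2$2) * l + (T$1$1 * T$2$2 - T$1$2 * T$2$1) = 0"
proof -
  obtain v where v: "v \<noteq> 0" "T *v v = l *s v" using assms unfolding is_eigenvalue_def by blast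
  have e1: "T$1$1 * v$1 + T$1$2 * v$2 = l * v$1"
    using arg_cong[OF v(2), of "\<lambda>v. v $ 1"] by (simp add: matrix_vector_mult_def sum_2)
  have e2: "T$2$1 * v$1 + T$2$2 * v$2 = l * v$2"
    using arg_cong[OF v(2), of "\<lambda>v. v $ 2"] by (simp add: matrix_vector_mult_def sum_2)
  have "(l\<^sup>2 - (T$1$1 + T$2$2) * l + (T$1$1 * T$2$2 - T$1$2 * T$2$1)) * v$1 = 0"
    using e1 e2 by algebra
  moreover have "(l\<^sup>2 - (T$1$1 + T$2$2) * l + (T$1$1 * T$2$2 - T$1$2 * T$2$1)) * v$2 = 0"
    using e1 e2 by algebra
  moreover have "v$1 \<noteq> 0 \<or> v$2 \<noteq> 0" using v(1) by (auto simp: vec_eq_iff forall_2)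
  ultimately show ?thesis by auto
qed

text \<open>
  Since \<open>det T = 1\<close>, the value \<open>l = 0\<close> would reduce the characteristic equation to \<open>1 = 0\<close>, and the trace of
  \<open>T\<close> is \<open>l + 1 / l\<close>.  The recurrences are Cayley-Hamilton, read off for the two components of the
  Cauchy data; the side conditions on \<open>n\<close> keep both transfer steps outside the defect.
\<close>

lemma eigenvalue_recurrence:
  assumes dm: "defect_medium h x c" and T: "is_transfer_matrix x c \<omega> T" and l: "is_eigenvalue T l"
  shows "l \<noteq> 0"
    and "is_solution c \<omega> u \<Longrightarrow> n \<noteq> 0 \<Longrightarrow> n + 1 \<noteq> 0 \<Longrightarrow>
      u (x (n + 2)) = of_real (l + 1 / l) * u (x (n + 1)) - u (x n)"
    and "is_solution c \<omega> u \<Longrightarrow> n \<noteq> 0 \<Longrightarrow> n + 1 \<noteq> 0 \<Longrightarrow>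
      D\<^sub>x u (x (n + 2)) = of_real (l + 1 / l) * D\<^sub>x u (x (n + 1)) - D\<^sub>x u (x n)"
proof -
  have det: "T$1$1 * T$2$2 - T$1$2 * T$2$1 = 1" by (rule transfer_matrix_det[OF dm T])
  then have char: "l\<^sup>2 - (T$1$1 + T$2$2) * l + 1 = 0"
    using eigenvalue_characteristic_equation[OF l] by simp
  then show l0: "l \<noteq> 0" by auto
  have trace: "l + 1 / l = T$1$1 + T$2$2"
    using char l0 by (simp add: field_simps power2_eq_square)
  have d: "complex_of_real (T$1$1) * of_real (T$2$2) = 1 + of_real (T$1$2) * of_real (T$2$1)"
    using arg_cong[OF det, of complex_of_real] by (simp add: algebra_simps)
  have dz: "of_real (T$1$1) * (of_real (T$2$2) * z) = z + of_real (T$1$2) * (of_real (T$2$1) * z)" for z :: complex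
    using arg_cong[OF d, of "\<lambda>w. w * z"] by (simp add: algebra_simps)
  have n2: "n + 2 = (n + 1) + 1" by simp
  assume u: "is_solution c \<omega> u" and n: "n \<noteq> 0" "n + 1 \<noteq> 0"
  note step = transfer_matrix_components[OF T u]
  show "u (x (n + 2)) = of_real (l + 1 / l) * u (x (n + 1)) - u (x n)"
    unfolding trace n2 step[OF n(2)] step[OF n(1)] using dz[of "u (x n)"] by (simp add: algebra_simps)
  show "D\<^sub>x u (x (n + 2)) = of_real (l + 1 / l) * D\<^sub>x u (x (n + 1)) - D\<^sub>x u (x n)"
    unfolding trace n2 step[OF n(2)] step[OF n(1)] using dz[of "D\<^sub>x u (x n)"] by (simp add: algebra_simps)
qed

text \<open>
  The operator \<open>E\<^sup>2 - (l + 1 / l) E + 1\<close>, with \<open>E\<close> the shift, factors as \<open>(E - 1 / l) (E - l)\<close>.  Hence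
  \<open>w = (E - l) z\<close> is geometric with ratio \<open>1 / l\<close>, which exceeds \<open>1\<close> in modulus; since \<open>z\<close>, and
  therefore \<open>w\<close>, tends to \<open>0\<close>, this forces \<open>w = 0\<close>.
\<close>

lemma decaying_recurrence_geometric:
  fixes z :: "nat \<Rightarrow> complex" and l :: real
  assumes l: "\<bar>l\<bar> < 1" "l \<noteq> 0" and z: "z \<longlonglongrightarrow> 0"
    and rec: "\<And>k. z (Suc (Suc k)) = of_real (l + 1 / l) * z (Suc k) - z k"
  shows "z k = of_real l ^ k * z 0"
proof -
  define w where "w k = z (Suc k) - of_real l * z k" for k
  have w: "of_real l ^ k * w k = w 0" for k
  proof (induction k)
    case (Suc k)
    have "of_real l * w (Suc k) = w k"
      using l(2) unfolding w_def rec[of k] by (simp add: field_simps)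
    moreover have "of_real l ^ Suc k * w (Suc k) = of_real l ^ k * (of_real l * w (Suc k))"
      by (simp only: power_Suc mult_ac)
    ultimately show ?case using Suc by simp
  qed simp
  have "w \<longlonglongrightarrow> 0 - of_real l * 0"
    unfolding w_def by (intro tendsto_intros z LIMSEQ_Suc)
  moreover have "(\<lambda>k. complex_of_real l ^ k) \<longlonglongrightarrow> 0"
    using l(1) by (intro LIMSEQ_power_zero) simp
  ultimately have "(\<lambda>k. of_real l ^ k * w k) \<longlonglongrightarrow> 0 * (0 - of_real l * 0)"
    by (intro tendsto_mult)
  then have "w 0 = 0" unfolding w by (simp add: LIMSEQ_const_iff)
  then have "w k = 0" for k using w[of k] l(2) by simp
  then have step: "z (Suc k) = of_real l * z k" for k by (simp add: w_def)
  show ?thesis by (induction k) (simp_all add: step)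
qed

text \<open>
  The hypothesis leaves out the indices whose recurrence involves the step from \<open>0\<close> to \<open>1\<close>, so the two sides
  are independent geometric sequences, starting at \<open>1\<close> and at \<open>0\<close>.  As the exponent \<open>\<bar>n\<bar>\<close>
  counts from \<open>0\<close>, the right side costs a factor \<open>1 / \<bar>l\<bar>\<close>.
\<close>

lemma decaying_two_sided_recurrence_bigo:
  fixes F :: "int \<Rightarrow> complex" and l :: real
  assumes l: "\<bar>l\<bar> < 1" "l \<noteq> 0"
    and lims: "(\<lambda>k. F (1 + int k)) \<longlonglongrightarrow> 0" "(\<lambda>k. F (- int k)) \<longlonglongrightarrow> 0"
    and rec: "\<And>n. n \<noteq> 0 \<Longrightarrow> n + 1 \<noteq> 0 \<Longrightarrow> F (n + 2) = of_real (l + 1 / l) * F (n + 1) - F n"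
  shows "F \<in> O[at_top](\<lambda>n. of_real (\<bar>l\<bar> ^ nat \<bar>n\<bar>))"
    and "F \<in> O[at_bot](\<lambda>n. of_real (\<bar>l\<bar> ^ nat \<bar>n\<bar>))"
proof -
  have "F (1 + int k) = of_real l ^ k * F (1 + int 0)" for k
  proof (rule decaying_recurrence_geometric[OF l lims(1)])
    show "F (1 + int (Suc (Suc k))) = of_real (l + 1 / l) * F (1 + int (Suc k)) - F (1 + int k)" for k
      using rec[of "1 + int k"] by (simp add: algebra_simps)
  qed
  then have right: "F (1 + int k) = of_real l ^ k * F 1" for k by simp
  have "F (- int k) = of_real l ^ k * F (- int 0)" for k
  proof (rule decaying_recurrence_geometric[OF l lims(2)])
    fix k
    have "- int (Suc (Suc k)) + 2 = - int k" "- int (Suc (Suc k)) + 1 = - int (Suc k)" by simp_all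
    then show "F (- int (Suc (Suc k))) = of_real (l + 1 / l) * F (- int (Suc k)) - F (- int k)"
      using rec[of "- int (Suc (Suc k))"] by simp
  qed
  then have left: "F (- int k) = of_real l ^ k * F 0" for k by simp
  have "norm (F n) \<le> norm (F 1) / \<bar>l\<bar> * norm (complex_of_real (\<bar>l\<bar> ^ nat \<bar>n\<bar>))" if n: "n \<ge> 1" for n
  proof -
    define k where "k = nat (n - 1)"
    have k: "n = 1 + int k" "nat \<bar>n\<bar> = Suc k" using n by (auto simp: k_def)
    show ?thesis using l(2) unfolding k(2) unfolding k(1) right by (simp add: norm_mult norm_power)
  qed
  then show "F \<in> O[at_top](\<lambda>n. of_real (\<bar>l\<bar> ^ nat \<bar>n\<bar>))"
    by (intro bigoI[where c = "norm (F 1) / \<bar>l\<bar>"] eventually_mono[OF eventually_ge_at_top[of 1]])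
  have "norm (F n) \<le> norm (F 0) * norm (complex_of_real (\<bar>l\<bar> ^ nat \<bar>n\<bar>))" if n: "n \<le> 0" for n
  proof -
    define k where "k = nat (- n)"
    have k: "n = - int k" "nat \<bar>n\<bar> = k" using n by (auto simp: k_def)
    show ?thesis unfolding k(2) unfolding k(1) left by (simp add: norm_mult norm_power)
  qed
  then show "F \<in> O[at_bot](\<lambda>n. of_real (\<bar>l\<bar> ^ nat \<bar>n\<bar>))"
    by (intro bigoI[where c = "norm (F 0)"] eventually_mono[OF eventually_le_at_bot[of 0]])
qed

theorem corollary2p5:
  fixes h \<omega> lambda\<^sub>1 :: real
    and x :: "int \<Rightarrow> real"
    and c :: "real \<Rightarrow> real"
    and u :: "real \<Rightarrow> complex"
    and T :: "real^2^2"
  assumes "defect_medium h x c"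
    and "is_transfer_matrix x c \<omega> T"
    and "localised_eigenmode c \<omega> u"
    and "\<omega> \<notin> medium_spectrum h (unperturbed h x c)"
    and "is_eigenvalue T lambda\<^sub>1" and "\<bar>lambda\<^sub>1\<bar> < 1"
  shows "(\<lambda>n. u (x n)) \<in> O[at_top](\<lambda>n. of_real (\<bar>lambda\<^sub>1\<bar> ^ nat \<bar>n\<bar>)) \<and>
         (\<lambda>n. D\<^sub>x u (x n)) \<in> O[at_top](\<lambda>n. of_real (\<bar>lambda\<^sub>1\<bar> ^ nat \<bar>n\<bar>)) \<and>
         (\<lambda>n. u (x n)) \<in> O[at_bot](\<lambda>n. of_real (\<bar>lambda\<^sub>1\<bar> ^ nat \<bar>n\<bar>)) \<and>
         (\<lambda>n. D\<^sub>x u (x n)) \<in> O[at_bot](\<lambda>n. of_real (\<bar>lambda\<^sub>1\<bar> ^ nat \<bar>n\<bar>))"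
proof -
  have u: "is_solution c \<omega> u" using assms(3) by (simp add: localised_eigenmode_def)
  note lims = localised_eigenmode_nodes_tendsto_zero[OF assms(1,3)]
  note rec = eigenvalue_recurrence[OF assms(1,2,5)]
  note bigo = decaying_two_sided_recurrence_bigo[OF assms(6) rec(1)]
  show ?thesis
    by (intro conjI bigo(1)[OF lims(1,2)] bigo(1)[OF lims(3,4)] bigo(2)[OF lims(1,2)] bigo(2)[OF lims(3,4)]
          rec(2)[OF u] rec(3)[OF u])
qed

end
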